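(* Let $\mathcal{A}=\{a_1,\dots,a_n\}\subset\mathbb{Z}^d$ and let $A\in\mathbb{Z}^{(d+1)\times n}$ be the matrix with columns $(1,a_1),\dots,(1,a_n)$. If $A$ and $C\in\mathbb{R}^{d\times n}$ are uniform matrices, $\mathbf{0}\in\mathcal{C}^\circ$, and $B\in\mathbb{Z}^{n\times k}$ is a Gale dual matrix of $A$ such that the lattice ideal $I_{\mathcal{L}_B}$ is a complete intersection, then there exists a Gale dual matrix $B'\in\mathbb{Z}^{n\times k}$ of $A$ satisfying the following condition: for every Gale dual matrix $D$ of $C$ such that $\Delta_P$ is nonempty and bounded, and for every $L\in\mathcal{F}(\Delta_P)$, the submatrix $B'_L$ of $B'$ formed by the rows with index in $L$ is not weakly mixed.
   Context: Setting: $d\ge1$, $n\ge d+2$, $k=n-d-1$, the $a_i$ are distinct. A matrix is uniform if all its maximal minors are nonzero. A Gale dual matrix of $M\in\mathbb{R}^{r\times s}$ of rank $r$ is any $N\in\mathbb{R}^{s\times(s-r)}$ whose columns form a basis of $\ker M$. $\mathcal{C}^\circ=\mathbb{R}_{>0}C_1+\dots+\mathbb{R}_{>0}C_n$, where $C_1,\dots,C_n$ are the columns of $C$. Lattice ideals: for an integer Gale dual matrix $B$ with columns $B_1,\dots,B_k$, $\mathcal{L}_B=\mathbb{Z}B_1\oplus\dots\oplus\mathbb{Z}B_k\subset\mathbb{Z}^n$. For a subgroup $\mathcal{L}\subset\mathbb{Z}^n$, $I_{\mathcal{L}}=\langle x^{u^+}-x^{u^-}:u\in\mathcal{L}\rangle\subset\mathbb{R}[x_1,\dots,x_n]$,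 where $u=u^+-u^-$ is the decomposition into positive and negative parts. $I_{\mathcal{L}_B}$ (an ideal of codimension $k$) is a complete intersection if it can be generated by as many polynomials as the codimension of its zero set, i.e. by $k$ polynomials. Polytope: for a Gale dual matrix $D\in\mathbb{R}^{n\times(k+1)}$ of $C$ with rows $P_1,\dots,P_n$, let $\mathcal{C}_P=\mathbb{R}_{>0}P_1+\dots+\mathbb{R}_{>0}P_n$, $\mathcal{C}_P^\nu=\{y\in\mathbb{R}^{k+1}:\langle P_i,y\rangle>0\ \forall i\}$, and $\Delta_P=\mathcal{C}_P^\nu\cap\{y_0=1\}$ (coordinates $y=(y_0,\dots,y_k)$), viewed in $\mathbb{R}^k$. Let $p_i(y)=\langle P_i,(1,y)\rangle$. $\bar I_C$ is the set of $i$ such that $P_i$ lies on the boundary of $\mathcal{C}_P$. A face of $\Delta_P$ means a face of its closure; for $i\in\bar I_C$, $F_i$ is the face supported on $p_i(y)=0$. For a (nonempty) proper face $F$, $L(F)=\{i\in\bar I_C:F\subset F_i\}$, and $\mathcal{F}(\Delta_P)=\{L(F):F\text{ a proper face of }\Delta_P\}$. A matrix is weakly mixed if each column either has only zero entries or contains both a strictly positive and a strictly negative entry. *)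

theory Defs
  imports "HOL-Analysis.Analysis" "HOL-Library.Poly_Mapping"
begin

text \<open>
  Dimensions are finite index types: \<open>'n\<close>, \<open>'d\<close>, \<open>'k\<close> index sets of sizes \<open>n\<close>, \<open>d\<close>, \<open>k\<close>.
  The sizes \<open>d + 1\<close> and \<open>k + 1\<close> are rendered by \<open>'d option\<close> and \<open>'k option\<close>, where \<open>None\<close> is
  the distinguished coordinate number \<open>0\<close>.
\<close>

section \<open>Matrices\<close>

text \<open>
  A choice of rows or columns is an injection of index types. Reordering only changes the sign of a
  minor. At most one of the two conjuncts is non-vacuous unless the matrix is square, and then
  they agree.
\<close>

definition uniform_matrix :: "'a::comm_ring_1 ^ 's ^ 'r \<Rightarrow> bool" where
  "uniform_matrix M \<longleftrightarrow>
     (\<forall>\<sigma> :: 'r \<Rightarrow> 's. inj \<sigma> \<longrightarrow> det (\<chi> i j. M $ i $ \<sigma> j) \<noteq> 0) \<and>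
     (\<forall>\<tau> :: 's \<Rightarrow> 'r. inj \<tau> \<longrightarrow> det (\<chi> i j. M $ \<tau> i $ j) \<noteq> 0)"

text \<open>
  The columns form a basis as a family, so they are pairwise distinct; together with the rank
  condition this forces the number of columns of \<open>N\<close> to be \<open>s - r\<close>.
\<close>

definition gale_dual :: "real ^ 's ^ 'r \<Rightarrow> real ^ 't ^ 's \<Rightarrow> bool" where
  "gale_dual M N \<longleftrightarrow>
     rank M = CARD('r) \<and>
     inj (\<lambda>j. column j N) \<and> independent (columns N) \<and> span (columns N) = {x. M *v x = 0}"

text \<open>For integer matrices the kernel is taken over the reals: the columns of \<open>N\<close> need not
  generate all integer points of the kernel.\<close>

definition int_gale_dual :: "int ^ 's ^ 'r \<Rightarrow> int ^ 't ^ 's \<Rightarrow> bool" where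
  "int_gale_dual M N \<longleftrightarrow> gale_dual (map_matrix real_of_int M) (map_matrix real_of_int N)"

definition prepend_one :: "'a::one ^ 'd \<Rightarrow> 'a ^ 'd option" where
  "prepend_one y = (\<chi> j. case j of None \<Rightarrow> 1 | Some i \<Rightarrow> y $ i)"

definition config_matrix :: "('n \<Rightarrow> int ^ 'd) \<Rightarrow> int ^ 'n ^ 'd option" where
  "config_matrix a = (\<chi> r i. prepend_one (a i) $ r)"

definition open_cone :: "('n::finite \<Rightarrow> real ^ 'm) \<Rightarrow> (real ^ 'm) set" where
  "open_cone v = {(\<Sum>i\<in>UNIV. c i *\<^sub>R v i) | c. \<forall>i. c i > 0}"

text \<open>Weak mixedness of the submatrix of \<open>M\<close> formed by the rows with index in \<open>L\<close>.\<close>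

definition weakly_mixed_rows :: "'n set \<Rightarrow> 'a::linordered_idom ^ 'k ^ 'n \<Rightarrow> bool" where
  "weakly_mixed_rows L M \<longleftrightarrow>
     (\<forall>j. (\<forall>i\<in>L. M $ i $ j = 0) \<or> ((\<exists>i\<in>L. M $ i $ j > 0) \<and> (\<exists>i\<in>L. M $ i $ j < 0)))"

section \<open>Lattice ideals\<close>

text \<open>Real polynomials with one variable for each element of \<open>'n\<close>.\<close>

type_synonym 'n rpoly = "('n \<Rightarrow>\<^sub>0 nat) \<Rightarrow>\<^sub>0 real"

text \<open>The ideal generated by a set is its span in the ring viewed as a module over itself.\<close>

interpretation ring_ideal: module "(*) :: 'a::comm_ring_1 \<Rightarrow> 'a \<Rightarrow> 'a"
  by unfold_locales (simp_all add: algebra_simps)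

definition column_lattice :: "int ^ 'k ^ 'n \<Rightarrow> (int ^ 'n) set" where
  "column_lattice B = {(\<Sum>j\<in>UNIV. m j *s column j B) | m. True}"

lift_definition pos_exponent :: "int ^ 'n \<Rightarrow> ('n \<Rightarrow>\<^sub>0 nat)" is "\<lambda>u i. nat (u $ i)"
  by simp

text \<open>The monomials are those with exponents \<open>u\<^sup>+\<close> and \<open>u\<^sup>- = (- u)\<^sup>+\<close>.\<close>

definition lattice_binomial :: "int ^ 'n \<Rightarrow> 'n rpoly" where
  "lattice_binomial u =
     Poly_Mapping.single (pos_exponent u) 1 - Poly_Mapping.single (pos_exponent (- u)) 1"

definition lattice_ideal :: "(int ^ 'n) set \<Rightarrow> 'n rpoly set" where
  "lattice_ideal \<L> = ring_ideal.span (lattice_binomial ` \<L>)"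

text \<open>
  The codimension \<open>c\<close> of the zero set of \<open>I\<close> is passed explicitly. For the lattice ideal of the span of
  \<open>k\<close> linearly independent columns of an integer matrix it is \<open>k\<close>.
\<close>

definition complete_intersection :: "nat \<Rightarrow> 'n rpoly set \<Rightarrow> bool" where
  "complete_intersection c I \<longleftrightarrow> (\<exists>fs. length fs = c \<and> ring_ideal.span (set fs) = I)"

section \<open>The polytope of a Gale dual matrix\<close>

definition dual_cone :: "real ^ 'm ^ 'n \<Rightarrow> (real ^ 'm) set" where
  "dual_cone D = {y. \<forall>i. row i D \<bullet> y > 0}"

text \<open>The slice of the dual cone by \<open>y\<^sub>0 = 1\<close>, in the remaining \<open>k\<close> coordinates.\<close>

definition Delta :: "real ^ 'k option ^ 'n \<Rightarrow> (real ^ 'k) set" where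
  "Delta D = {y. prepend_one y \<in> dual_cone D}"

definition boundary_indices :: "real ^ 'm ^ 'n \<Rightarrow> 'n set" where
  "boundary_indices D = {i. row i D \<in> frontier (open_cone (\<lambda>i. row i D))}"

definition face_at :: "real ^ 'k::finite option ^ 'n \<Rightarrow> 'n \<Rightarrow> (real ^ 'k) set" where
  "face_at D i = {y \<in> closure (Delta D). row i D \<bullet> prepend_one y = 0}"

definition face_index_set :: "real ^ 'k::finite option ^ 'n \<Rightarrow> (real ^ 'k) set \<Rightarrow> 'n set" where
  "face_index_set D F = {i \<in> boundary_indices D. F \<subseteq> face_at D i}"

definition face_index_sets :: "real ^ 'k::finite option ^ 'n \<Rightarrow> 'n set set" where
  "face_index_sets D =
     {face_index_set D F | F. F face_of closure (Delta D) \<and> F \<noteq> {} \<and> F \<noteq> closure (Delta D)}"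

end

theory Submission
  imports Defs
begin

text \<open>
  By the graded Nakayama lemma, a complete intersection lattice ideal is generated by \<open>k\<close> of its own
  binomials. Their exponent vectors span the kernel of \<open>A\<close>: if \<open>w\<close> is orthogonal to them, their binomials
  vanish at \<open>(exp w\<^sub>1, \<dots>, exp w\<^sub>n)\<close>, hence so do all binomials of the lattice, which makes \<open>w\<close>
  orthogonal to the lattice. So they are the columns of a Gale dual matrix \<open>B'\<close>.

  The index set \<open>L\<close> of a proper face is nonempty and has at most \<open>k\<close> elements since \<open>C\<close> is uniform.
  Uniformity of \<open>A\<close> then gives a lattice vector \<open>u\<close> that is positive on \<open>L\<close>. If \<open>B'\<close> were weakly mixed
  on \<open>L\<close>, all generators would vanish at the point with coordinates 0 on \<open>L\<close> and 1 elsewhere, but the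
  binomial of \<open>u\<close> does not.
\<close>

text \<open>The rule \<open>a * (b * x) = (a * b) * x\<close> makes the simplifier loop together with \<open>algebra_simps\<close>.\<close>

declare ring_ideal.scale_scale [simp del]

section \<open>Polynomials\<close>

lemma poly_mapping_single_induct [case_names zero single add]:
  assumes "P 0" "\<And>m c. P (Poly_Mapping.single m c)" "\<And>p q. P p \<Longrightarrow> P q \<Longrightarrow> P (p + q)"
  shows "P (p :: 'a \<Rightarrow>\<^sub>0 'b::comm_monoid_add)"
proof -
  have "p = (\<Sum>m\<in>Poly_Mapping.keys p. Poly_Mapping.single m (Poly_Mapping.lookup p m))"
    by (rule poly_mapping_eqI)
      (auto simp: lookup_sum lookup_single when_def in_keys_iff)
  moreover have "P (\<Sum>m\<in>M. Poly_Mapping.single m (Poly_Mapping.lookup p m))" if "finite M" for M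
    using that by induction (auto intro: assms)
  ultimately show ?thesis
    by (metis finite_keys)
qed

text \<open>Scalars act as constant polynomials, so ideals and linear spans share one
  product.\<close>

interpretation poly_vs: vector_space
  "\<lambda>c p. Poly_Mapping.single 0 c * p :: 'a::comm_monoid_add \<Rightarrow>\<^sub>0 'b::field"
  by unfold_locales (simp_all add: distrib_left distrib_right single_add mult_single flip: mult.assoc)

lemma lookup_scale:
  "Poly_Mapping.lookup (Poly_Mapping.single 0 c * p) m = c * Poly_Mapping.lookup p m"
  for p :: "'a::comm_monoid_add \<Rightarrow>\<^sub>0 'b::comm_semiring_1"
  by (auto simp: map.rep_eq when_def simp flip: mult_map_scale_conv_mult)

text \<open>Every polynomial is a sum of terms. This turns statements about ideal generators into
  linear algebra, where generators can be exchanged.\<close>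

lemma ring_ideal_span_eq_poly_vs_span:
  fixes S :: "('a::comm_monoid_add \<Rightarrow>\<^sub>0 'b::field) set"
  shows "ring_ideal.span S = poly_vs.span {Poly_Mapping.single m 1 * s | m s. s \<in> S}" (is "_ = ?V")
proof
  have mult: "p * s \<in> ?V" if "s \<in> S" for p s
  proof (induction p rule: poly_mapping_single_induct)
    case (single m c)
    have "Poly_Mapping.single m c * s = Poly_Mapping.single 0 c * (Poly_Mapping.single m 1 * s)"
      by (simp add: mult_single flip: mult.assoc)
    also have "\<dots> \<in> ?V"
      using that by (intro poly_vs.span_scale poly_vs.span_base) blast
    finally show ?case .
  qed (auto simp: poly_vs.span_zero distrib_right intro: poly_vs.span_add)
  show "ring_ideal.span S \<subseteq> ?V"
  proof
    fix p assume "p \<in> ring_ideal.span S"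
    then show "p \<in> ?V"
      by (induction rule: ring_ideal.span_induct_alt)
        (auto simp: poly_vs.span_zero intro: poly_vs.span_add mult)
  qed
  show "?V \<subseteq> ring_ideal.span S"
    by (intro poly_vs.span_minimal poly_vs.subspaceI)
      (auto intro: ring_ideal.span_scale ring_ideal.span_base ring_ideal.span_add ring_ideal.span_zero)
qed

section \<open>Evaluation at real points\<close>

definition poly_eval :: "('n::finite \<Rightarrow> real) \<Rightarrow> 'n rpoly \<Rightarrow> real" where
  "poly_eval x p = (\<Sum>m\<in>Poly_Mapping.keys p.
     Poly_Mapping.lookup p m * (\<Prod>i\<in>UNIV. x i ^ Poly_Mapping.lookup m i))"

lemma poly_eval_superset:
  assumes "finite M" "Poly_Mapping.keys p \<subseteq> M"
  shows "poly_eval x p = (\<Sum>m\<in>M. Poly_Mapping.lookup p m * (\<Prod>i\<in>UNIV. x i ^ Poly_Mapping.lookup m i))"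
  unfolding poly_eval_def using assms by (intro sum.mono_neutral_left) (auto simp: in_keys_iff)

lemma poly_eval_0 [simp]: "poly_eval x 0 = 0"
  by (simp add: poly_eval_def)

lemma poly_eval_single:
  "poly_eval x (Poly_Mapping.single m c) = c * (\<Prod>i\<in>UNIV. x i ^ Poly_Mapping.lookup m i)"
  by (subst poly_eval_superset[where M = "{m}"]) auto

lemma poly_eval_add: "poly_eval x (p + q) = poly_eval x p + poly_eval x q"
proof -
  let ?M = "Poly_Mapping.keys p \<union> Poly_Mapping.keys q"
  have "poly_eval x r = (\<Sum>m\<in>?M. Poly_Mapping.lookup r m * (\<Prod>i\<in>UNIV. x i ^ Poly_Mapping.lookup m i))"
    if "r \<in> {p, q, p + q}" for r
    using that keys_add[of p q] by (intro poly_eval_superset) auto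
  then show ?thesis
    by (simp add: lookup_add algebra_simps sum.distrib)
qed

lemma poly_eval_diff: "poly_eval x (p - q) = poly_eval x p - poly_eval x q"
  using poly_eval_add[of x "p - q" q] by simp

lemma poly_eval_mult: "poly_eval x (p * q) = poly_eval x p * poly_eval x q"
proof (induction p rule: poly_mapping_single_induct)
  case (single m c)
  show ?case
  proof (induction q rule: poly_mapping_single_induct)
    case (single m' c')
    show ?case
      by (simp add: mult_single poly_eval_single lookup_add power_add prod.distrib)
  qed (simp_all add: poly_eval_add algebra_simps)
qed (simp_all add: poly_eval_add algebra_simps)

text \<open>Evaluation is a ring homomorphism, so the polynomials vanishing at a point form an
  ideal.\<close>

lemma poly_eval_eq_0_on_span:
  assumes "p \<in> ring_ideal.span S" "\<And>s. s \<in> S \<Longrightarrow> poly_eval x s = 0"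
  shows "poly_eval x p = 0"
  using assms(1) by (induction rule: ring_ideal.span_induct_alt)
    (simp_all add: poly_eval_add poly_eval_mult assms(2))

lemma poly_eval_lattice_binomial:
  "poly_eval x (lattice_binomial u) = (\<Prod>i\<in>UNIV. x i ^ nat (u $ i)) - (\<Prod>i\<in>UNIV. x i ^ nat (- u $ i))"
  by (simp add: lattice_binomial_def poly_eval_diff poly_eval_single pos_exponent.rep_eq)

section \<open>Homogeneous ideals\<close>

definition total_deg :: "('n::finite \<Rightarrow>\<^sub>0 nat) \<Rightarrow> nat" where
  "total_deg m = (\<Sum>i\<in>UNIV. Poly_Mapping.lookup m i)"

lemma total_deg_add: "total_deg (m + m') = total_deg m + total_deg m'"
  by (simp add: total_deg_def lookup_add sum.distrib)

lemma total_deg_eq_0_iff: "total_deg m = 0 \<longleftrightarrow> m = 0"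
  by (auto simp: total_deg_def intro!: poly_mapping_eqI)

definition homogeneous :: "nat \<Rightarrow> (('n::finite \<Rightarrow>\<^sub>0 nat) \<Rightarrow>\<^sub>0 'b::zero) \<Rightarrow> bool" where
  "homogeneous D p \<longleftrightarrow> (\<forall>m\<in>Poly_Mapping.keys p. total_deg m = D)"

lemma homogeneous_single_mult:
  fixes p :: "('n::finite \<Rightarrow>\<^sub>0 nat) \<Rightarrow>\<^sub>0 'b::semiring_0"
  assumes "homogeneous D p"
  shows "homogeneous (total_deg m + D) (Poly_Mapping.single m c * p)"
  unfolding homogeneous_def
proof
  fix m' assume "m' \<in> Poly_Mapping.keys (Poly_Mapping.single m c * p)"
  then obtain m'' where "m' = m + m''" "m'' \<in> Poly_Mapping.keys p"
    using keys_mult[of "Poly_Mapping.single m c" p] by (auto split: if_splits)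
  then show "total_deg m' = total_deg m + D"
    using assms by (simp add: total_deg_add homogeneous_def)
qed

definition degree_part :: "nat \<Rightarrow> (('n::finite \<Rightarrow>\<^sub>0 nat) \<Rightarrow>\<^sub>0 'b::zero) \<Rightarrow> (('n \<Rightarrow>\<^sub>0 nat) \<Rightarrow>\<^sub>0 'b)" where
  "degree_part D = Poly_Mapping.mapp (\<lambda>m c. c when total_deg m = D)"

lemma lookup_degree_part:
  "Poly_Mapping.lookup (degree_part D p) m = (Poly_Mapping.lookup p m when total_deg m = D)"
  by (auto simp: degree_part_def lookup_mapp when_def in_keys_iff)

lemma degree_part_homogeneous:
  assumes "homogeneous D p"
  shows "degree_part D' p = (if D' = D then p else 0)"
proof (rule poly_mapping_eqI)
  fix m
  have "Poly_Mapping.lookup p m = 0" if "total_deg m \<noteq> D"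
    using assms that by (metis homogeneous_def in_keys_iff)
  then show "Poly_Mapping.lookup (degree_part D' p) m = Poly_Mapping.lookup (if D' = D then p else 0) m"
    by (auto simp: lookup_degree_part when_def)
qed

text \<open>Steinitz exchange modulo the span of \<open>W\<close>. Each chosen element of
  \<open>G\<close> moves into \<open>W\<close> and takes the place of one element of
  \<open>F\<close>, which is why \<open>W\<close> is arbitrary in the induction.\<close>

lemma (in vector_space) exchange_finite_generators:
  assumes "finite F" "G \<subseteq> span (W \<union> F)"
  shows "\<exists>T\<subseteq>G. finite T \<and> card T \<le> card F \<and> G \<subseteq> span (W \<union> T)"
  using assms
proof (induction F arbitrary: W rule: finite_induct)
  case empty
  then show ?case by (intro exI[of _ "{}"]) auto
next
  case (insert f F)
  show ?case
  proof (cases "G \<subseteq> span (W \<union> F)")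
    case True
    then obtain T where "T \<subseteq> G" "finite T" "card T \<le> card F" "G \<subseteq> span (W \<union> T)"
      using insert.IH by blast
    then show ?thesis
      using insert.hyps by auto
  next
    case False
    then obtain g where g: "g \<in> G" "g \<notin> span (W \<union> F)"
      by blast
    \<comment> \<open>Any expression of \<open>g\<close> must involve \<open>f\<close> with a
      nonzero coefficient, so it can be solved for \<open>f\<close>.\<close>
    then have f: "f \<in> span (insert g W \<union> F)"
      using insert.prems in_span_insert[of g f "W \<union> F"] by auto
    then have "insert f (W \<union> F) \<subseteq> span (insert g W \<union> F)"
      by (auto intro: span_base)
    then have "span (insert f (W \<union> F)) \<subseteq> span (insert g W \<union> F)"
      by (intro span_minimal subspace_span)
    then have "G \<subseteq> span (insert g W \<union> F)"
      using insert.prems by auto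
    then obtain T where T: "T \<subseteq> G" "finite T" "card T \<le> card F" "G \<subseteq> span (insert g W \<union> T)"
      using insert.IH by blast
    with g insert.hyps show ?thesis
      by (intro exI[of _ "insert g T"]) (auto simp: card_insert_if)
  qed
qed

text \<open>Graded Nakayama lemma. With \<open>\<mm>\<close> the ideal of the variables, the exchange is carried out in
  the vector space \<open>I / \<mm>I\<close>: the set \<open>W\<close> spans \<open>\<mm>I\<close>.\<close>

lemma homogeneous_generators_subset:
  fixes G :: "(('n::finite \<Rightarrow>\<^sub>0 nat) \<Rightarrow>\<^sub>0 'b::field) set"
  assumes hom: "\<And>g. g \<in> G \<Longrightarrow> \<exists>D. homogeneous D g"
    and F: "finite F" "ring_ideal.span F = ring_ideal.span G"
  shows "\<exists>T\<subseteq>G. finite T \<and> card T \<le> card F \<and> ring_ideal.span T = ring_ideal.span G"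
proof -
  define W where "W = {Poly_Mapping.single m 1 * g | m g. m \<noteq> 0 \<and> g \<in> G}"
  have W: "Poly_Mapping.single m 1 * p \<in> poly_vs.span W" if "p \<in> ring_ideal.span G" "m \<noteq> 0" for p m
    using that(1) unfolding ring_ideal_span_eq_poly_vs_span
  proof (induction rule: poly_vs.span_induct)
    case base
    have "Poly_Mapping.single m 1 * (Poly_Mapping.single 0 c * x) \<in> poly_vs.span W"
      if "Poly_Mapping.single m 1 * x \<in> poly_vs.span W" for c x
      unfolding mult.left_commute[of "Poly_Mapping.single m 1"] using that by (rule poly_vs.span_scale)
    then show ?case
      by (intro poly_vs.subspaceI) (simp_all add: poly_vs.span_zero distrib_left poly_vs.span_add)
  next
    case (step x)
    then obtain m' g where x: "x = Poly_Mapping.single m' 1 * g" "g \<in> G"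
      by auto
    have "Poly_Mapping.single m 1 * x = Poly_Mapping.single (m + m') 1 * g"
      by (simp add: x mult_single flip: mult.assoc)
    moreover have "m + m' \<noteq> 0"
      using \<open>m \<noteq> 0\<close> total_deg_add[of m m'] by (simp flip: total_deg_eq_0_iff)
    ultimately show ?case
      using x unfolding W_def by (auto intro!: poly_vs.span_base)
  qed
  \<comment> \<open>Modulo \<open>W\<close> only the constant multiples of the generators
    \<open>F\<close> survive, so \<open>F\<close> spans the quotient linearly.\<close>
  have "Poly_Mapping.single m 1 * f \<in> poly_vs.span (W \<union> F)" if "f \<in> F" for m f
  proof (cases "m = 0")
    case True
    then show ?thesis
      using that by (auto intro: poly_vs.span_base)
  next
    case False
    then show ?thesis
      using W[of f m] that F(2) poly_vs.span_mono[of W "W \<union> F"] ring_ideal.span_base by blast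
  qed
  then have "ring_ideal.span F \<subseteq> poly_vs.span (W \<union> F)"
    unfolding ring_ideal_span_eq_poly_vs_span by (intro poly_vs.span_minimal) auto
  then have "G \<subseteq> poly_vs.span (W \<union> F)"
    using F(2) ring_ideal.span_superset[of G] by simp
  then obtain T where T: "T \<subseteq> G" "finite T" "card T \<le> card F" "G \<subseteq> poly_vs.span (W \<union> T)"
    using poly_vs.exchange_finite_generators[OF F(1), of G W] by blast
  \<comment> \<open>Generation modulo \<open>W\<close> lifts to generation by induction on the
    degree.\<close>
  have "g \<in> ring_ideal.span T" if "g \<in> G" "homogeneous D g" for D g
    using that
  proof (induction D arbitrary: g rule: less_induct)
    case (less D)
    have "g \<in> poly_vs.span (W \<union> T)"
      using less.prems T by auto
    \<comment> \<open>Passing to the component of degree \<open>D\<close> keeps \<open>g\<close> and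
      removes all summands of other degrees, to which the induction hypothesis need not
      apply.\<close>
    then have "degree_part D g \<in> ring_ideal.span T"
    proof (induction rule: poly_vs.span_induct)
      case base
      have "degree_part D 0 = (0 :: ('n \<Rightarrow>\<^sub>0 nat) \<Rightarrow>\<^sub>0 'b)"
        "degree_part D (p + q) = degree_part D p + degree_part D q"
        "degree_part D (Poly_Mapping.single 0 c * p) = Poly_Mapping.single 0 c * degree_part D p"
        for p q :: "('n \<Rightarrow>\<^sub>0 nat) \<Rightarrow>\<^sub>0 'b" and c
        by (auto intro!: poly_mapping_eqI simp: lookup_degree_part lookup_add lookup_scale when_def)
      then show ?case
        by (intro poly_vs.subspaceI)
          (auto simp: ring_ideal.span_zero intro: ring_ideal.span_add ring_ideal.span_scale)
    next
      case (step x)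
      then consider "x \<in> T" | m h where "x = Poly_Mapping.single m 1 * h" "m \<noteq> 0" "h \<in> G"
        by (auto simp: W_def)
      then show ?case
      proof cases
        case 1
        then obtain E where "homogeneous E x"
          using hom T by blast
        then show ?thesis
          using 1 by (auto simp: degree_part_homogeneous ring_ideal.span_zero ring_ideal.span_base)
      next
        case 2
        then obtain E where E: "homogeneous E h"
          using hom by blast
        \<comment> \<open>A nontrivial monomial has positive degree, so \<open>E < D\<close> and the
          induction hypothesis covers \<open>h\<close>.\<close>
        have "x \<in> ring_ideal.span T" if "total_deg m + E = D"
          using less.IH[of E h] 2 E that total_deg_eq_0_iff[of m] by (auto intro: ring_ideal.span_scale)
        then show ?thesis
          using homogeneous_single_mult[OF E, of m 1]
          by (auto simp: degree_part_homogeneous 2(1) ring_ideal.span_zero)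
      qed
    qed
    then show ?case
      using less.prems by (simp add: degree_part_homogeneous)
  qed
  then have "G \<subseteq> ring_ideal.span T"
    using hom by blast
  then have "ring_ideal.span T = ring_ideal.span G"
    using T(1) by (simp add: ring_ideal.span_minimal ring_ideal.span_mono subset_antisym)
  then show ?thesis
    using T by blast
qed

text \<open>Coordinate sum zero gives both monomials of a binomial the same degree. The graded
  Nakayama lemma then replaces arbitrary generators by lattice binomials without increasing their
  number.\<close>

lemma lattice_ideal_few_generators:
  fixes \<L> :: "(int ^ 'n::finite) set"
  assumes hom: "\<And>u. u \<in> \<L> \<Longrightarrow> (\<Sum>i\<in>UNIV. u $ i) = 0"
    and ci: "complete_intersection c (lattice_ideal \<L>)"
  shows "\<exists>U\<subseteq>\<L>. finite U \<and> card U \<le> c \<and> lattice_ideal U = lattice_ideal \<L>"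
proof -
  obtain fs where fs: "length fs = c" "ring_ideal.span (set fs) = ring_ideal.span (lattice_binomial ` \<L>)"
    using ci unfolding complete_intersection_def lattice_ideal_def by blast
  have "homogeneous (total_deg (pos_exponent u)) (lattice_binomial u)" if "u \<in> \<L>" for u
  proof -
    have "int (total_deg (pos_exponent u)) - int (total_deg (pos_exponent (- u))) = (\<Sum>i\<in>UNIV. u $ i)"
      by (auto simp: total_deg_def pos_exponent.rep_eq simp flip: sum_subtractf intro!: sum.cong)
    then have "total_deg (pos_exponent (- u)) = total_deg (pos_exponent u)"
      using hom[OF that] by simp
    then show ?thesis
      by (auto simp: homogeneous_def lattice_binomial_def in_keys_iff lookup_minus lookup_single when_def
          split: if_splits)
  qed
  then obtain T where T: "T \<subseteq> lattice_binomial ` \<L>" "finite T" "card T \<le> card (set fs)"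
    "ring_ideal.span T = ring_ideal.span (lattice_binomial ` \<L>)"
    using homogeneous_generators_subset[OF _ _ fs(2)] by fastforce
  moreover obtain U where "U \<subseteq> \<L>" "inj_on lattice_binomial U" "T = lattice_binomial ` U"
    using T(1) by (meson subset_image_inj)
  moreover have "card (set fs) \<le> c"
    using fs(1) card_length by blast
  ultimately have "finite U" "card U \<le> c" "lattice_ideal U = lattice_ideal \<L>" "U \<subseteq> \<L>"
    unfolding lattice_ideal_def by (auto simp: finite_image_iff card_image)
  then show ?thesis
    by blast
qed


section \<open>Uniform matrices and Gale duality\<close>

lemma det_map_matrix_of_int:
  "det (map_matrix real_of_int M) = real_of_int (det M)"
  by (simp add: det_def)

lemma uniform_matrix_of_int:
  assumes "uniform_matrix M"
  shows "uniform_matrix (map_matrix real_of_int M)"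
proof -
  have "det (\<chi> i j. map_matrix real_of_int M $ i $ \<sigma> j) = real_of_int (det (\<chi> i j. M $ i $ \<sigma> j))"
    "det (\<chi> i j. map_matrix real_of_int M $ \<tau> i $ j) = real_of_int (det (\<chi> i j. M $ \<tau> i $ j))" for \<sigma> \<tau>
    by (simp_all add: map_matrix_def flip: det_map_matrix_of_int)
  then show ?thesis
    using assms unfolding uniform_matrix_def of_int_eq_0_iff by (simp del: nth_map_matrix)
qed

lemma uniform_matrix_selection:
  fixes M :: "real ^ 's ^ 'r"
  assumes "uniform_matrix M" "card S = CARD('r)"
  obtains \<sigma> :: "'r \<Rightarrow> 's" where "inj \<sigma>" "range \<sigma> = S" "invertible (\<chi> i j. M $ i $ \<sigma> j)"
proof -
  obtain \<sigma> :: "'r \<Rightarrow> 's" where "bij_betw \<sigma> UNIV S"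
    using finite_same_card_bij[of "UNIV :: 'r set" S] assms(2) by auto
  then show ?thesis
    using that assms(1) unfolding uniform_matrix_def bij_betw_def by (metis invertible_det_nz)
qed

text \<open>Enlarge \<open>S\<close> to exactly as many columns as there are rows; these are
  linearly independent because their minor is nonzero.\<close>

lemma uniform_matrix_kernel_eq_0:
  fixes M :: "real ^ 's ^ 'r"
  assumes M: "uniform_matrix M" and S: "card S \<le> CARD('r)" "CARD('r) \<le> CARD('s)"
    and x: "M *v x = 0" "\<And>i. i \<notin> S \<Longrightarrow> x $ i = 0"
  shows "x = 0"
proof -
  obtain S' where S': "S \<subseteq> S'" "card S' = CARD('r)"
    using exists_subset_between[of S "CARD('r)" UNIV] S by auto
  obtain \<sigma> :: "'r \<Rightarrow> 's" where \<sigma>: "inj \<sigma>" "range \<sigma> = S'" "invertible (\<chi> i j. M $ i $ \<sigma> j)"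
    using uniform_matrix_selection[OF M S'(2)] .
  let ?N = "\<chi> i j. M $ i $ \<sigma> j" and ?y = "\<chi> j. x $ \<sigma> j"
  have "(?N *v ?y) $ i = (M *v x) $ i" for i
  proof -
    have "(M *v x) $ i = (\<Sum>j\<in>range \<sigma>. M $ i $ j * x $ j)"
      unfolding matrix_vector_mult_def vec_lambda_beta using S' \<sigma> x(2)
      by (intro sum.mono_neutral_right) auto
    then show ?thesis
      by (simp add: matrix_vector_mult_def sum.reindex[OF \<sigma>(1)])
  qed
  then have "?N *v ?y = ?N *v 0"
    by (simp add: vec_eq_iff x(1))
  then have y: "?y = 0"
    using \<sigma>(3) inj_matrix_vector_mult[of ?N] by (simp only: inj_eq)
  show ?thesis
  proof (subst vec_eq_iff, intro allI)
    fix i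
    show "x $ i = 0 $ i"
      using y x(2)[of i] S'(1) \<sigma>(2) by (cases "i \<in> range \<sigma>") (auto simp: vec_eq_iff)
  qed
qed

text \<open>Entries outside \<open>S\<close> can be chosen freely: an invertible maximal square
  block with columns in \<open>S\<close> solves for the rest.\<close>

lemma uniform_matrix_kernel_prescribed:
  fixes M :: "real ^ 's ^ 'r"
  assumes M: "uniform_matrix M" and S: "CARD('r) \<le> card S"
  obtains x where "M *v x = 0" "\<And>i. i \<notin> S \<Longrightarrow> x $ i = z $ i"
proof -
  obtain S' where S': "S' \<subseteq> S" "card S' = CARD('r)"
    using obtain_subset_with_card_n[OF S] by metis
  obtain \<sigma> :: "'r \<Rightarrow> 's" where \<sigma>: "inj \<sigma>" "range \<sigma> = S'" "invertible (\<chi> i j. M $ i $ \<sigma> j)"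
    using uniform_matrix_selection[OF M S'(2)] .
  let ?N = "\<chi> i j. M $ i $ \<sigma> j"
  \<comment> \<open>\<open>w\<close> carries the prescribed entries; \<open>v\<close>, supported on
    \<open>S'\<close>, will cancel its image under \<open>M\<close>.\<close>
  define w where "w = (\<chi> i. if i \<in> S' then 0 else z $ i)"
  obtain y where y: "?N *v y = - (M *v w)"
    using \<sigma>(3) matrix_right_invertible_surjective[of ?N] unfolding invertible_def surj_def by metis
  define v where "v = (\<chi> i. if i \<in> S' then y $ inv \<sigma> i else 0)"
  have "(M *v v) $ i = (?N *v y) $ i" for i
  proof -
    have "(M *v v) $ i = (\<Sum>j\<in>range \<sigma>. M $ i $ j * v $ j)"
      unfolding matrix_vector_mult_def vec_lambda_beta using \<sigma>
      by (intro sum.mono_neutral_right) (auto simp: v_def)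
    then show ?thesis
      using \<sigma> by (auto simp: matrix_vector_mult_def sum.reindex[OF \<sigma>(1)] v_def intro!: sum.cong)
  qed
  then have "M *v v = - (M *v w)"
    using y by (simp add: vec_eq_iff)
  then have "M *v (w + v) = 0"
    by (simp add: matrix_vector_right_distrib)
  moreover have "(w + v) $ i = z $ i" if "i \<notin> S" for i
    using that S'(1) by (auto simp: w_def v_def)
  ultimately show ?thesis
    by (rule that)
qed

lemma gale_dual_kernel:
  assumes "gale_dual M N"
  shows "M *v x = 0 \<longleftrightarrow> (\<exists>c. x = N *v c)"
proof -
  have "{x. M *v x = 0} = span (columns N)"
    using assms by (simp add: gale_dual_def)
  also have "\<dots> = range ((*v) N)"
  proof
    show "span (columns N) \<subseteq> range ((*v) N)"
      by (intro span_minimal linear_subspace_image)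
        (auto simp: columns_image_basis)
  qed (auto simp: matrix_vector_mult_in_columnspace)
  finally show ?thesis
    by blast
qed

lemma gale_dual_inj:
  fixes M :: "real ^ 'b ^ 'a" and N :: "real ^ 'c ^ 'b"
  assumes "gale_dual M N"
  shows "inj ((*v) N)"
proof -
  have "columns N = range (\<lambda>j. column j N)"
    by (auto simp: columns_def)
  moreover have "inj (\<lambda>j. column j N)" "independent (columns N)"
    using assms by (auto simp: gale_dual_def)
  ultimately have "dim (columns N) = CARD('c)"
    by (metis card_image dim_eq_card_independent)
  then show ?thesis
    by (simp add: column_rank_def flip: full_rank_injective)
qed

section \<open>Integer vectors and lattices in the real kernel\<close>

definition real_vec :: "int ^ 'n \<Rightarrow> real ^ 'n" where
  "real_vec u = (\<chi> i. real_of_int (u $ i))"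

lemma inj_real_vec: "inj real_vec"
  by (auto simp: inj_def real_vec_def vec_eq_iff)

lemma real_vec_lattice:
  "real_vec (\<Sum>j\<in>UNIV. m j *s column j B) = map_matrix real_of_int B *v (\<chi> j. real_of_int (m j))"
  by (simp add: real_vec_def vec_eq_iff matrix_vector_mult_def column_def mult.commute)

lemma column_lattice_kernel:
  assumes "int_gale_dual A B" "u \<in> column_lattice B"
  shows "map_matrix real_of_int A *v real_vec u = 0"
proof -
  obtain m where "u = (\<Sum>j\<in>UNIV. m j *s column j B)"
    using assms(2) unfolding column_lattice_def by blast
  then show ?thesis
    using gale_dual_kernel[of "map_matrix real_of_int A" "map_matrix real_of_int B" "real_vec u"] assms(1)
    unfolding int_gale_dual_def by (auto simp: real_vec_lattice)
qed

lemma column_in_column_lattice: "column j B \<in> column_lattice B"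
proof -
  have "column j B = (\<Sum>l\<in>UNIV. (if l = j then 1 else 0) *s column l B)"
    by (simp add: vec_eq_iff if_distrib[of "\<lambda>c. c * _"] cong: if_cong)
  then show ?thesis
    unfolding column_lattice_def by fast
qed

text \<open>The row of \<open>config_matrix a\<close> with index \<open>None\<close> consists of
  ones.\<close>

lemma column_lattice_sum_eq_0:
  assumes "int_gale_dual (config_matrix a) B" "u \<in> column_lattice B"
  shows "(\<Sum>i\<in>UNIV. u $ i) = 0"
proof -
  have "0 = (map_matrix real_of_int (config_matrix a) *v real_vec u) $ None"
    using column_lattice_kernel[OF assms] by simp
  also have "\<dots> = real_of_int (\<Sum>i\<in>UNIV. u $ i)"
    by (simp add: matrix_vector_mult_def config_matrix_def prepend_one_def real_vec_def)
  finally have "real_of_int (\<Sum>i\<in>UNIV. u $ i) = 0"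
    by (rule sym)
  then show ?thesis
    by (simp only: of_int_eq_0_iff)
qed

text \<open>A real kernel vector equal to 1 on \<open>Z\<close> is scaled by a large
  \<open>N\<close>. Rounding its coefficients with respect to the columns of \<open>B\<close>,
  rather than its entries, keeps the result in the lattice.\<close>

lemma column_lattice_positive_on:
  fixes A :: "int ^ 'n ^ 'r" and B :: "int ^ 'k ^ 'n"
  assumes A: "uniform_matrix A" and B: "int_gale_dual A B" and Z: "CARD('r) \<le> card (- Z)"
  shows "\<exists>u \<in> column_lattice B. \<forall>i\<in>Z. u $ i > 0"
proof -
  let ?A = "map_matrix real_of_int A" and ?B = "map_matrix real_of_int B"
  obtain x where x: "?A *v x = 0" "\<And>i. i \<in> Z \<Longrightarrow> x $ i = 1"
    using uniform_matrix_kernel_prescribed[OF uniform_matrix_of_int[OF A] Z, of 1] by auto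
  obtain c where c: "x = ?B *v c"
    using x(1) gale_dual_kernel[of ?A ?B x] B unfolding int_gale_dual_def by blast
  \<comment> \<open>The double sum bounds the rounding error in every row; the extra 1 keeps the
    rounded entries on \<open>Z\<close> strictly positive.\<close>
  define N where "N = (\<Sum>i\<in>UNIV. \<Sum>j\<in>UNIV. real_of_int \<bar>B $ i $ j\<bar>) + 1"
  define m where "m j = \<lfloor>N * c $ j\<rfloor>" for j
  define u where "u = (\<Sum>j\<in>UNIV. m j *s column j B)"
  have "u $ i > 0" if "i \<in> Z" for i
  proof -
    have "N = N * (\<Sum>j\<in>UNIV. real_of_int (B $ i $ j) * c $ j)"
      using x(2)[OF that] by (simp add: c matrix_vector_mult_def)
    also have "\<dots> = (\<Sum>j\<in>UNIV. real_of_int (B $ i $ j) * (N * c $ j))"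
      by (simp add: sum_distrib_left mult_ac)
    finally have N: "N = \<dots>" .
    have "real_of_int (u $ i) = (\<Sum>j\<in>UNIV. real_of_int (B $ i $ j) * real_of_int (m j))"
      by (simp add: u_def column_def mult.commute)
    with N have "N - real_of_int (u $ i) = (\<Sum>j\<in>UNIV. real_of_int (B $ i $ j) * (N * c $ j - real_of_int (m j)))"
      by (simp only: right_diff_distrib sum_subtractf)
    also have "\<dots> \<le> (\<Sum>j\<in>UNIV. real_of_int \<bar>B $ i $ j\<bar>)"
    proof (rule sum_mono)
      fix j
      have "\<bar>N * c $ j - real_of_int (m j)\<bar> \<le> 1"
        unfolding m_def by linarith
      then have "\<bar>real_of_int (B $ i $ j)\<bar> * \<bar>N * c $ j - real_of_int (m j)\<bar> \<le> \<bar>real_of_int (B $ i $ j)\<bar> * 1"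
        by (intro mult_left_mono) auto
      then show "real_of_int (B $ i $ j) * (N * c $ j - real_of_int (m j)) \<le> real_of_int \<bar>B $ i $ j\<bar>"
        by (simp flip: abs_mult)
    qed
    also have "\<dots> \<le> (\<Sum>i\<in>UNIV. \<Sum>j\<in>UNIV. real_of_int \<bar>B $ i $ j\<bar>)"
      by (rule member_le_sum) (auto intro: sum_nonneg)
    finally show ?thesis
      unfolding N_def by linarith
  qed
  moreover have "u \<in> column_lattice B"
    unfolding u_def column_lattice_def by blast
  ultimately show ?thesis
    by blast
qed

text \<open>Once \<open>U\<close> is known to span the kernel, its size, at most the dimension,
  makes it a basis.\<close>

lemma gale_dual_of_lattice_ideal_generators:
  fixes A :: "int ^ 'n ^ 'r" and B :: "int ^ 'k ^ 'n"
  assumes B: "int_gale_dual A B"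
    and U: "U \<subseteq> column_lattice B" "finite U" "card U \<le> CARD('k)"
    and gen: "lattice_ideal U = lattice_ideal (column_lattice B)"
  obtains B' :: "int ^ 'k ^ 'n" where "int_gale_dual A B'" "columns B' = U"
proof -
  let ?A = "map_matrix real_of_int A" and ?B = "map_matrix real_of_int B" and ?U = "real_vec ` U"
  have Bd: "rank ?A = CARD('r)" "inj (\<lambda>j. column j ?B)" "independent (columns ?B)"
    "span (columns ?B) = {x. ?A *v x = 0}"
    using B by (auto simp: int_gale_dual_def gale_dual_def)
  have colsB: "columns ?B = range (\<lambda>j. real_vec (column j B))"
    by (auto simp: columns_def real_vec_def column_def)
  have sub: "span ?U \<subseteq> span (columns ?B)"
    using U(1) column_lattice_kernel[OF B] by (intro span_minimal subspace_span) (auto simp: Bd(4))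
  have span: "span ?U = span (columns ?B)"
  proof (rule ccontr)
    assume "span ?U \<noteq> span (columns ?B)"
    then obtain w where w: "w \<noteq> 0" "w \<in> span (columns ?B)" "\<And>y. y \<in> span ?U \<Longrightarrow> orthogonal w y"
      using orthogonal_to_subspace_exists_gen[of ?U "columns ?B"] sub by blast
    \<comment> \<open>At this point a monomial takes the value \<open>exp\<close> of the inner
      product of \<open>w\<close> with its exponent. As \<open>exp\<close> is injective, the
      binomial vanishes exactly when the two inner products agree.\<close>
    have ev: "poly_eval (\<lambda>i. exp (w $ i)) (lattice_binomial u) = 0 \<longleftrightarrow> w \<bullet> real_vec u = 0" for u
    proof -
      have "poly_eval (\<lambda>i. exp (w $ i)) (lattice_binomial u) =
          exp (\<Sum>i\<in>UNIV. w $ i * real (nat (u $ i))) - exp (\<Sum>i\<in>UNIV. w $ i * real (nat (- u $ i)))"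
        by (simp add: poly_eval_lattice_binomial exp_sum mult.commute flip: exp_of_nat_mult)
      moreover have "(\<Sum>i\<in>UNIV. w $ i * real (nat (u $ i))) - (\<Sum>i\<in>UNIV. w $ i * real (nat (- u $ i)))
          = w \<bullet> real_vec u"
        by (auto simp: inner_vec_def real_vec_def simp flip: sum_subtractf right_diff_distrib intro!: sum.cong)
      ultimately show ?thesis
        by auto
    qed
    have "w \<bullet> real_vec u = 0" if "u \<in> column_lattice B" for u
    proof -
      have "lattice_binomial u \<in> ring_ideal.span (lattice_binomial ` U)"
        using that gen unfolding lattice_ideal_def by (metis imageI ring_ideal.span_base)
      then have "poly_eval (\<lambda>i. exp (w $ i)) (lattice_binomial u) = 0"
        by (rule poly_eval_eq_0_on_span) (use w(3) ev in \<open>auto simp: orthogonal_def span_base\<close>)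
      then show ?thesis
        by (simp add: ev)
    qed
    then have "orthogonal w y" if "y \<in> columns ?B" for y
      using that column_in_column_lattice by (auto simp: colsB orthogonal_def)
    then have "orthogonal w w"
      using orthogonal_to_span[OF w(2)] by blast
    then show False
      using w(1) by (simp add: orthogonal_self)
  qed
  have dim: "dim (span ?U) = CARD('k)"
    using Bd(2) dim_eq_card_independent[OF Bd(3)]
    by (simp add: span columns_def full_SetCompr_eq card_image)
  have "card ?U \<le> CARD('k)"
    using U(2,3) card_image_le le_trans by blast
  then have "independent ?U" "card ?U = CARD('k)"
    using card_le_dim_spanning[of ?U "span ?U"] dim U(2) dim_le_card[of "span ?U" ?U]
    by (auto simp: span_superset)
  moreover have "card ?U = card U"
    by (meson card_image inj_on_subset inj_real_vec subset_UNIV)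
  ultimately obtain \<phi> :: "'k \<Rightarrow> int ^ 'n" where \<phi>: "bij_betw \<phi> UNIV U"
    using finite_same_card_bij[of "UNIV :: 'k set" U] U(2) by auto
  define B' :: "int ^ 'k ^ 'n" where "B' = (\<chi> i j. \<phi> j $ i)"
  have col: "column j B' = \<phi> j" "column j (map_matrix real_of_int B') = real_vec (\<phi> j)" for j
    by (simp_all add: B'_def column_def real_vec_def)
  have cols: "columns B' = U" "columns (map_matrix real_of_int B') = ?U"
    using \<phi> by (auto simp: columns_def col bij_betw_def)
  have "inj (\<lambda>j. column j (map_matrix real_of_int B'))"
    using \<phi> inj_real_vec by (auto simp: col bij_betw_def inj_def)
  then have "int_gale_dual A B'"
    using \<open>independent ?U\<close> Bd span by (simp add: int_gale_dual_def gale_dual_def cols)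
  then show ?thesis
    using that cols by blast
qed

lemma not_weakly_mixed_rows:
  assumes gen: "lattice_binomial u \<in> lattice_ideal (columns B)"
    and u: "\<And>i. i \<in> Z \<Longrightarrow> u $ i > 0" and Z: "Z \<noteq> {}"
  shows "\<not> weakly_mixed_rows Z B"
proof
  assume mixed: "weakly_mixed_rows Z B"
  define x :: "'a \<Rightarrow> real" where "x i = of_bool (i \<notin> Z)" for i
  \<comment> \<open>Here \<open>0 ^ 0 = 1\<close> matters: a monomial vanishes only if some variable
    from \<open>Z\<close> really occurs in it.\<close>
  have prod: "(\<Prod>i\<in>UNIV. x i ^ nat (v i)) = of_bool (\<forall>i\<in>Z. v i \<le> 0)" for v :: "'a \<Rightarrow> int"
  proof (cases "\<forall>i\<in>Z. v i \<le> 0")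
    case True
    then have "x i ^ nat (v i) = 1" for i
      by (auto simp: x_def)
    then show ?thesis
      using True by simp
  next
    case False
    then show ?thesis
      by (auto simp: x_def not_le intro!: prod_zero)
  qed
  \<comment> \<open>A column that is zero on \<open>Z\<close> gives \<open>1 - 1\<close>, a column
    with both signs on \<open>Z\<close> gives \<open>0 - 0\<close>.\<close>
  have "poly_eval x (lattice_binomial (column j B)) = 0" for j
    using mixed unfolding weakly_mixed_rows_def poly_eval_lattice_binomial prod
    by (force simp: column_def not_le dest: spec[of _ j])
  then have "poly_eval x (lattice_binomial u) = 0"
    by (intro poly_eval_eq_0_on_span[OF gen[unfolded lattice_ideal_def]]) (auto simp: columns_def)
  \<comment> \<open>The first monomial vanishes because \<open>Z\<close> is nonempty; the second
    contains no variable from \<open>Z\<close>.\<close>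
  moreover have "poly_eval x (lattice_binomial u) = - 1"
    using u Z unfolding poly_eval_lattice_binomial prod by (force simp: not_le less_imp_le)
  ultimately show False
    by simp
qed

section \<open>Faces of the polytope\<close>

lemma inner_row: "row i D \<bullet> z = (D *v z) $ i"
  by (simp add: row_def inner_vec_def matrix_vector_mult_def)

text \<open>For \<open>y\<close> in \<open>F\<close>, the vector \<open>D *v prepend_one y\<close>
  lies in the kernel of \<open>C\<close> and vanishes on the index set. With too few entries left it
  would be 0 by uniformity, and then so would \<open>prepend_one y\<close>, whose coordinate
  \<open>None\<close> is 1.\<close>

lemma card_face_index_set:
  fixes C :: "real ^ 'n ^ 'd" and D :: "real ^ 'k::finite option ^ 'n"
  assumes C: "uniform_matrix C" "CARD('d) \<le> CARD('n)" and D: "gale_dual C D" and F: "F \<noteq> {}"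
  shows "CARD('d) < card (- face_index_set D F)"
proof (rule ccontr)
  assume card: "\<not> ?thesis"
  obtain y where y: "y \<in> F"
    using F by blast
  let ?z = "prepend_one y"
  have "(D *v ?z) $ i = 0" if "i \<notin> - face_index_set D F" for i
    using that y by (auto simp: face_index_set_def face_at_def inner_row)
  moreover have "C *v (D *v ?z) = 0"
    using gale_dual_kernel[OF D] by blast
  ultimately have "D *v ?z = 0"
    using uniform_matrix_kernel_eq_0[OF C(1) _ C(2), of "- face_index_set D F" "D *v ?z"] card by auto
  then have "D *v ?z = D *v 0"
    by simp
  then have "?z = 0"
    using gale_dual_inj[OF D] by (simp only: inj_eq)
  then have "?z $ None = 0"
    by simp
  then show False
    by (simp add: prepend_one_def)
qed

lemma prepend_one_affine:
  fixes x y :: "real ^ 'k"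
  shows "prepend_one ((1 - e) *\<^sub>R x + e *\<^sub>R y) = (1 - e) *\<^sub>R prepend_one x + e *\<^sub>R prepend_one y"
  by (auto simp: vec_eq_iff prepend_one_def split: option.split)

lemma continuous_on_prepend_one:
  "continuous_on S (prepend_one :: real ^ 'k::finite \<Rightarrow> real ^ 'k option)"
  unfolding prepend_one_def
proof (intro continuous_on_vec_lambda)
  fix j
  show "continuous_on S (\<lambda>y :: real ^ 'k. case j of None \<Rightarrow> 1 | Some i \<Rightarrow> y $ i)"
    by (cases j) (auto intro: continuous_intros)
qed

lemma open_Delta: "open (Delta D)"
proof -
  have "Delta D = (\<Inter>i. {y. 0 < row i D \<bullet> prepend_one y})"
    by (auto simp: Delta_def dual_cone_def)
  also have "open \<dots>"
    by (intro open_INT ballI open_Collect_less continuous_intros continuous_on_prepend_one) auto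
  finally show ?thesis .
qed

lemma closure_Delta_nonneg:
  assumes "y \<in> closure (Delta D)"
  shows "0 \<le> row i D \<bullet> prepend_one y"
proof -
  have "closed {y. 0 \<le> row i D \<bullet> prepend_one y}"
    by (intro closed_Collect_le continuous_intros continuous_on_prepend_one)
  moreover have "Delta D \<subseteq> {y. 0 \<le> row i D \<bullet> prepend_one y}"
    by (auto simp: Delta_def dual_cone_def less_imp_le)
  ultimately show ?thesis
    using closure_minimal assms by blast
qed

text \<open>The vector \<open>z\<close> is normal to a hyperplane that supports the cone at row
  \<open>i\<close>.\<close>

lemma boundary_indicesI:
  fixes D :: "real ^ 'm ^ 'n"
  assumes nonneg: "\<And>j. 0 \<le> row j D \<bullet> z" and zero: "row i D \<bullet> z = 0" and z: "z \<noteq> 0"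
  shows "i \<in> boundary_indices D"
proof -
  let ?K = "open_cone (\<lambda>i. row i D)"
  \<comment> \<open>The row itself need not lie in the open cone; adding a small multiple of all
    rows makes every coefficient positive.\<close>
  let ?p = "\<lambda>n. row i D + (1 / real (Suc n)) *\<^sub>R (\<Sum>j\<in>UNIV. row j D)"
  have "?p n \<in> ?K" for n
  proof -
    have "?p n = (\<Sum>j\<in>UNIV. (of_bool (j = i) + 1 / real (Suc n)) *\<^sub>R row j D)"
      by (simp add: scaleR_add_left sum.distrib scaleR_sum_right of_bool_def if_distrib[of "\<lambda>c. c *\<^sub>R _"] cong: if_cong)
    then show ?thesis
      unfolding open_cone_def by (auto intro!: exI[of _ "\<lambda>j. of_bool (j = i) + 1 / real (Suc n)"] add_nonneg_pos)
  qed
  moreover have "?p \<longlonglongrightarrow> row i D + 0 *\<^sub>R (\<Sum>j\<in>UNIV. row j D)"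
    by (intro tendsto_intros LIMSEQ_Suc[OF lim_1_over_n])
  ultimately have "row i D \<in> closure ?K"
    unfolding closure_sequential by (intro exI[of _ ?p]) simp
  moreover have "row i D \<notin> interior ?K"
  proof
    assume "row i D \<in> interior ?K"
    moreover have "?K \<subseteq> {v. 0 \<le> z \<bullet> v}"
      using nonneg
      by (auto simp: open_cone_def inner_sum_right inner_commute less_imp_le intro!: sum_nonneg mult_nonneg_nonneg)
    ultimately have "row i D \<in> interior {v. 0 \<le> z \<bullet> v}"
      using interior_mono by blast
    then show False
      using interior_halfspace_ge[OF z, of 0] zero inner_commute[of z "row i D"] by simp
  qed
  ultimately show ?thesis
    by (simp add: boundary_indices_def frontier_def)
qed

text \<open>A proper face misses the open polytope, so one of the defining affine forms vanishes at
  a relative interior point of \<open>F\<close>. Being nonnegative on \<open>F\<close>, this form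
  vanishes on all of \<open>F\<close>.\<close>

lemma face_index_set_nonempty:
  assumes F: "F face_of closure (Delta D)" "F \<noteq> {}" "F \<noteq> closure (Delta D)"
  shows "face_index_set D F \<noteq> {}"
proof -
  have F_sub: "F \<subseteq> closure (Delta D)" and conv: "convex F"
    using F(1) face_of_imp_subset face_of_imp_convex by blast+
  obtain x where x: "x \<in> rel_interior F"
    using F(2) conv rel_interior_eq_empty by blast
  then have xF: "x \<in> F"
    using rel_interior_subset by blast
  have "Delta D \<subseteq> rel_interior (closure (Delta D))"
    using open_Delta interior_maximal[OF closure_subset] interior_subset_rel_interior by blast
  then have "x \<notin> Delta D"
    using face_of_disjoint_rel_interior[OF F(1,3)] xF by blast
  then obtain i where "row i D \<bullet> prepend_one x \<le> 0"
    by (auto simp: Delta_def dual_cone_def not_less)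
  then have zero: "row i D \<bullet> prepend_one x = 0"
    using closure_Delta_nonneg[of x D i] xF F_sub by auto
  have "prepend_one x $ None \<noteq> (0 :: real)"
    by (simp add: prepend_one_def)
  then have "prepend_one x \<noteq> 0"
    by auto
  then have "i \<in> boundary_indices D"
    using boundary_indicesI closure_Delta_nonneg xF F_sub zero by blast
  moreover have "F \<subseteq> face_at D i"
  proof
    fix y assume y: "y \<in> F"
    \<comment> \<open>The segment from \<open>y\<close> to \<open>x\<close> extends beyond
      \<open>x\<close> within \<open>F\<close>. There the form equals its value at \<open>y\<close>
      times the negative factor \<open>1 - e\<close>.\<close>
    obtain e where e: "e > 1" "(1 - e) *\<^sub>R y + e *\<^sub>R x \<in> F"
      using x y conv F(2) convex_rel_interior_iff by blast
    then have "0 \<le> row i D \<bullet> prepend_one ((1 - e) *\<^sub>R y + e *\<^sub>R x)"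
      using closure_Delta_nonneg F_sub by blast
    then have "0 \<le> (1 - e) * (row i D \<bullet> prepend_one y)"
      by (simp add: prepend_one_affine inner_add_right zero)
    then have "row i D \<bullet> prepend_one y \<le> 0"
      using e(1) by (simp add: zero_le_mult_iff)
    then show "y \<in> face_at D i"
      using closure_Delta_nonneg[of y D i] y F_sub by (auto simp: face_at_def)
  qed
  ultimately show ?thesis
    by (auto simp: face_index_set_def)
qed

theorem corollary6p2:
  fixes a :: "'n::finite \<Rightarrow> int ^ 'd::finite"
    and C :: "real ^ 'n ^ 'd"
    and B :: "int ^ 'k::finite ^ 'n"
  assumes "CARD('d) \<ge> 1"
    and "CARD('n) \<ge> CARD('d) + 2"
    and "CARD('k) = CARD('n) - CARD('d) - 1"
    and "inj a"
    and "uniform_matrix (config_matrix a)"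
    and "uniform_matrix C"
    and "0 \<in> open_cone (\<lambda>i. column i C)"
    and "int_gale_dual (config_matrix a) B"
    and "complete_intersection CARD('k) (lattice_ideal (column_lattice B))"
  shows "\<exists>B' :: int ^ 'k ^ 'n. int_gale_dual (config_matrix a) B' \<and>
           (\<forall>D :: real ^ 'k option ^ 'n.
              gale_dual C D \<and> Delta D \<noteq> {} \<and> bounded (Delta D) \<longrightarrow>
              (\<forall>L \<in> face_index_sets D. \<not> weakly_mixed_rows L B'))"
proof -
  \<comment> \<open>The generators, and with them \<open>B'\<close>, are fixed before
    \<open>D\<close>, so one matrix serves all polytopes.\<close>
  obtain U where U: "U \<subseteq> column_lattice B" "finite U" "card U \<le> CARD('k)"
    "lattice_ideal U = lattice_ideal (column_lattice B)"
    using lattice_ideal_few_generators[OF column_lattice_sum_eq_0[OF assms(8)] assms(9)] by blast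
  obtain B' :: "int ^ 'k ^ 'n" where B': "int_gale_dual (config_matrix a) B'" "columns B' = U"
    using gale_dual_of_lattice_ideal_generators[OF assms(8) U] .
  have "\<not> weakly_mixed_rows L B'"
    if D: "gale_dual C D" and L: "L \<in> face_index_sets D" for D :: "real ^ 'k option ^ 'n" and L
  proof -
    obtain F where F: "L = face_index_set D F" "F face_of closure (Delta D)" "F \<noteq> {}"
      "F \<noteq> closure (Delta D)"
      using L unfolding face_index_sets_def by blast
    \<comment> \<open>The strict bound from the uniformity of \<open>C\<close> supplies the
      \<open>d + 1\<close> indices outside \<open>L\<close> required by the \<open>d + 1\<close>
      rows of \<open>config_matrix a\<close>.\<close>
    have "CARD('d option) \<le> card (- L)"
      using card_face_index_set[OF assms(6) _ D F(3)] assms(2) by (simp add: F(1))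
    then obtain u where u: "u \<in> column_lattice B" "\<And>i. i \<in> L \<Longrightarrow> u $ i > 0"
      using column_lattice_positive_on[OF assms(5,8)] by blast
    have "lattice_binomial u \<in> lattice_ideal (column_lattice B)"
      using u(1) unfolding lattice_ideal_def by (intro ring_ideal.span_base) blast
    then have "lattice_binomial u \<in> lattice_ideal (columns B')"
      by (simp only: B'(2) U(4))
    then show ?thesis
      using u(2) face_index_set_nonempty[OF F(2-4)] F(1) by (intro not_weakly_mixed_rows) auto
  qed
  then show ?thesis
    using B'(1) by blast
qed

end
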